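(* Let $C_{123}(x,p,q,r)=\sum_{n\geq0}x^n\sum_{\sigma\in\mathcal{Q}_n(123)}p^{\mathrm{plat}(\sigma)}q^{\mathrm{des}(\sigma)}r^{\mathrm{asc}(\sigma)}$, a formal power series in $x$. Then $f=q\,C_{123}(x,p,q,r)-q+1$ satisfies $$f=1+pqx\Big(-1+\big(2+x(pr+qr-pq)\big)f-pqx\big(1-x(p-r)(q-r)\big)f^2\Big)f.$$
   Context: A Stirling permutation of order $n$ is a permutation $\sigma=\sigma_1\cdots\sigma_{2n}$ of the multiset $\{1,1,2,2,\ldots,n,n\}$ such that, for each $i\in[n]$, every entry between the two occurrences of $i$ is greater than $i$; $\mathcal{Q}_n$ is the set of these ($\mathcal{Q}_0$ consists of the empty word). For $\sigma\in\mathcal{Q}_n$: $\mathrm{des}(\sigma)$, $\mathrm{asc}(\sigma)$, $\mathrm{plat}(\sigma)$ are the numbers of $i\in\{1,\dots,2n-1\}$ with $\sigma_i>\sigma_{i+1}$, $\sigma_i<\sigma_{i+1}$, $\sigma_i=\sigma_{i+1}$ respectively. $\mathcal{Q}_n(123)$ is the set of $\sigma\in\mathcal{Q}_n$ with no subsequence $\sigma_{i_1}<\sigma_{i_2}<\sigma_{i_3}$, $i_1<i_2<i_3$. *)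

theory Defs
  imports
    "HOL-Library.Multiset"
    "HOL-Computational_Algebra.Formal_Power_Series"
begin

text \<open>List positions count from 0, so the entry \<open>\<sigma>\<^sub>i\<close> of a word is \<open>\<sigma> ! (i - 1)\<close>.\<close>

definition stirling_perms :: "nat \<Rightarrow> nat list set" where
  "stirling_perms n =
     {\<sigma>. mset \<sigma> = mset_set {1..n} + mset_set {1..n} \<and>
         (\<forall>a b c. a < b \<and> b < c \<and> c < length \<sigma> \<and> \<sigma> ! a = \<sigma> ! c \<longrightarrow> \<sigma> ! b > \<sigma> ! a)}"

definition des :: "nat list \<Rightarrow> nat" where
  "des \<sigma> = card {i. Suc i < length \<sigma> \<and> \<sigma> ! i > \<sigma> ! Suc i}"

definition asc :: "nat list \<Rightarrow> nat" where
  "asc \<sigma> = card {i. Suc i < length \<sigma> \<and> \<sigma> ! i < \<sigma> ! Suc i}"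

definition plat :: "nat list \<Rightarrow> nat" where
  "plat \<sigma> = card {i. Suc i < length \<sigma> \<and> \<sigma> ! i = \<sigma> ! Suc i}"

definition avoids_123 :: "nat list \<Rightarrow> bool" where
  "avoids_123 \<sigma> \<longleftrightarrow>
     \<not> (\<exists>a b c. a < b \<and> b < c \<and> c < length \<sigma> \<and> \<sigma> ! a < \<sigma> ! b \<and> \<sigma> ! b < \<sigma> ! c)"

definition stirling_perms_123 :: "nat \<Rightarrow> nat list set" where
  "stirling_perms_123 n = {\<sigma> \<in> stirling_perms n. avoids_123 \<sigma>}"

text \<open>
  The weights \<open>p\<close>, \<open>q\<close>, \<open>r\<close> are elements of an arbitrary commutative ring; indeterminates
  are the case where that ring is the polynomial ring in \<open>p\<close>, \<open>q\<close>, \<open>r\<close> over the integers.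
\<close>

definition C123 :: "'a::comm_ring_1 \<Rightarrow> 'a \<Rightarrow> 'a \<Rightarrow> 'a fps" where
  "C123 p q r =
     Abs_fps (\<lambda>n. \<Sum>\<sigma>\<in>stirling_perms_123 n. p ^ plat \<sigma> * q ^ des \<sigma> * r ^ asc \<sigma>)"

text \<open>The sum in \<open>C123\<close> would be 0 by convention over an infinite index set.\<close>

lemma finite_stirling_perms_123: "finite (stirling_perms_123 n)"
proof (rule finite_subset)
  show "stirling_perms_123 n \<subseteq> {\<sigma>. mset \<sigma> = mset_set {1..n} + mset_set {1..n}}"
    by (auto simp: stirling_perms_123_def stirling_perms_def)
  show "finite {\<sigma>. mset \<sigma> = mset_set {1..n} + mset_set {1..n}}"
    by (rule finite_subset[OF _ finite_lists_length_eq[of "{1..n}" "2 * n"]])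
      (auto dest: mset_eq_setD mset_eq_length simp flip: set_mset_mset size_mset)
qed

end

theory Submission
  imports Defs
begin

text \<open>
  A member of \<open>stirling_perms_123 (n + 1)\<close> arises uniquely from one of \<open>stirling_perms_123 n\<close> by
  inserting the factor \<open>(n + 1)(n + 1)\<close> behind a weakly decreasing prefix. Append \<open>0\<close> to
  every word, so that each nonempty word gains one factor \<open>q\<close>. The initial weakly
  decreasing run then always alternates plateau, descent, plateau, \<dots>, hence its length \<open>k\<close>
  alone determines the weights of all insertions: a run ended by an ascent has children
  \<open>k + 2\<close> and \<open>1, \<dots>, k\<close>, while the run of the decreasing word \<open>n n \<dots> 1 1 0\<close>, which is never ended by an
  ascent, has its own rule. Let \<open>G k\<close> and \<open>H k\<close> count the descendants in these two cases.
  Shifting \<open>k\<close> by 2 only multiplies the inhomogeneous term of the linear system by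
  \<open>\<Lambda> = 1 + qrx G 1 + prx G 2\<close> (called \<open>growth\<close>), so \<open>G (k + 2) = \<Lambda> G k\<close> and
  \<open>H (k + 2) = \<Lambda> H k\<close>. Then \<open>G 1\<close>, \<open>G 2\<close>, \<open>\<Lambda>\<close> and \<open>f = H 0\<close> satisfy four polynomial equations,
  from which the first three are eliminated.
\<close>

section \<open>Conditions on all triples of letters\<close>

fun avoid3 :: "('b \<Rightarrow> 'b \<Rightarrow> 'b \<Rightarrow> bool) \<Rightarrow> 'b list \<Rightarrow> bool" where
  "avoid3 P [] \<longleftrightarrow> True"
| "avoid3 P (x # xs) \<longleftrightarrow> sorted_wrt (P x) xs \<and> avoid3 P xs"

text \<open>The conjuncts sort the triples of positions by how many of the three fall into
  \<open>xs\<close>: three, none, one, two.\<close>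

lemma avoid3_append:
  "avoid3 P (xs @ ys) \<longleftrightarrow> avoid3 P xs \<and> avoid3 P ys \<and>
     (\<forall>a\<in>set xs. sorted_wrt (P a) ys) \<and> (\<forall>c\<in>set ys. sorted_wrt (\<lambda>a b. P a b c) xs)"
proof (induction xs)
  case (Cons x xs)
  show ?case
    unfolding append_Cons avoid3.simps sorted_wrt_append Cons.IH list.set sorted_wrt.simps by blast
qed simp

lemma avoid3_iff_nth:
  "avoid3 P xs \<longleftrightarrow>
     (\<forall>a b c. a < b \<and> b < c \<and> c < length xs \<longrightarrow> P (xs ! a) (xs ! b) (xs ! c))"
proof (induction xs)
  case (Cons x xs)
  have *: "(\<forall>a b c. a < b \<and> b < c \<and> c < length (x # xs) \<longrightarrow>
           P ((x # xs) ! a) ((x # xs) ! b) ((x # xs) ! c)) \<longleftrightarrow>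
        (\<forall>b c. b < c \<and> c < length xs \<longrightarrow> P x (xs ! b) (xs ! c)) \<and>
        (\<forall>a b c. a < b \<and> b < c \<and> c < length xs \<longrightarrow> P (xs ! a) (xs ! b) (xs ! c))"
    (is "?L \<longleftrightarrow> ?R")
  proof
    assume L: ?L
    show ?R
    proof (intro conjI allI impI)
      fix b c assume "b < c \<and> c < length xs"
      then show "P x (xs ! b) (xs ! c)" using L[rule_format, of 0 "Suc b" "Suc c"] by simp
    next
      fix a b c assume "a < b \<and> b < c \<and> c < length xs"
      then show "P (xs ! a) (xs ! b) (xs ! c)"
        using L[rule_format, of "Suc a" "Suc b" "Suc c"] by simp
    qed
  next
    assume R: ?R
    show ?L
    proof (intro allI impI)
      fix a b c assume *: "a < b \<and> b < c \<and> c < length (x # xs)"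
      then have "b \<noteq> 0" "c \<noteq> 0" by linarith+
      then obtain b' c' where "b = Suc b'" "c = Suc c'"
        using not0_implies_Suc by blast
      with * have **: "b' < c'" "c' < length xs" "a < Suc b'" by simp_all
      have "P ((x # xs) ! a) (xs ! b') (xs ! c')"
      proof (cases a)
        case 0
        then show ?thesis using R ** by simp
      next
        case (Suc a')
        then show ?thesis using R[THEN conjunct2, rule_format, of a' b' c'] ** by simp
      qed
      then show "P ((x # xs) ! a) ((x # xs) ! b) ((x # xs) ! c)"
        by (simp add: \<open>b = Suc b'\<close> \<open>c = Suc c'\<close>)
    qed
  qed
  have "sorted_wrt (P x) xs \<longleftrightarrow>
      (\<forall>b c. b < c \<and> c < length xs \<longrightarrow> P x (xs ! b) (xs ! c))"
    unfolding sorted_wrt_iff_nth_less by blast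
  then show ?case
    by (simp only: avoid3.simps Cons.IH *)
qed simp

text \<open>Both defining conditions speak of three positions, so one ternary predicate carries them
  and \<open>avoid3_append\<close> splits them together.\<close>

definition allowed :: "nat \<Rightarrow> nat \<Rightarrow> nat \<Rightarrow> bool" where
  "allowed a b c \<longleftrightarrow> (a = c \<longrightarrow> a < b) \<and> \<not> (a < b \<and> b < c)"

lemma stirling_perms_123_iff:
  "\<sigma> \<in> stirling_perms_123 n \<longleftrightarrow>
     mset \<sigma> = mset_set {1..n} + mset_set {1..n} \<and> avoid3 allowed \<sigma>"
proof -
  have "(\<forall>a b c. a < b \<and> b < c \<and> c < length \<sigma> \<and> \<sigma> ! a = \<sigma> ! c \<longrightarrow> \<sigma> ! b > \<sigma> ! a) \<and>
      avoids_123 \<sigma> \<longleftrightarrow> avoid3 allowed \<sigma>" (is "?S \<and> ?A \<longleftrightarrow> ?R")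
  proof
    assume "?S \<and> ?A"
    then show ?R unfolding avoids_123_def avoid3_iff_nth allowed_def by blast
  next
    assume R: ?R
    show "?S \<and> ?A"
      using R[unfolded avoid3_iff_nth, rule_format] unfolding avoids_123_def allowed_def by blast
  qed
  then show ?thesis
    unfolding stirling_perms_123_def stirling_perms_def by blast
qed

lemma stirling_perms_123_0: "stirling_perms_123 0 = {[]}"
  by (auto simp: stirling_perms_123_iff)

lemma set_stirling_perms_123:
  assumes "\<sigma> \<in> stirling_perms_123 n"
  shows "set \<sigma> = {1..n}"
proof -
  have "set_mset (mset \<sigma>) = set_mset (mset_set {1..n} + mset_set {1..n})"
    using assms unfolding stirling_perms_123_iff by metis
  then show ?thesis by simp
qed

section \<open>Insertion and removal of the largest letter\<close>

lemma sorted_wrtI: "(\<And>x y. x \<in> set xs \<Longrightarrow> y \<in> set xs \<Longrightarrow> R x y) \<Longrightarrow> sorted_wrt R xs"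
  by (induction xs) auto

text \<open>The maximum is never the lower end of an ascent, and its two copies have nothing between
  them. Hence a new triple could only go wrong by ending in \<open>Suc n\<close> after an ascent
  within \<open>A\<close>, which weak decrease excludes.\<close>

lemma insert_max_stirling_perms_123:
  assumes "A @ B \<in> stirling_perms_123 n" "sorted_wrt (\<ge>) A"
  shows "A @ [Suc n, Suc n] @ B \<in> stirling_perms_123 (Suc n)"
proof -
  have le: "x \<le> n" if "x \<in> set A \<union> set B" for x
    using set_stirling_perms_123[OF assms(1)] that by auto
  have *: "mset (A @ B) = mset_set {1..n} + mset_set {1..n}" "avoid3 allowed (A @ B)"
    using assms(1) by (auto simp: stirling_perms_123_iff)
  have "mset (A @ [Suc n, Suc n] @ B) = mset_set {1..Suc n} + mset_set {1..Suc n}"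
    using *(1) by (simp add: atLeastAtMostSuc_conv)
  moreover have "sorted_wrt (allowed (Suc n)) B"
    by (rule sorted_wrtI) (use le in \<open>force simp: allowed_def\<close>)
  moreover have "sorted_wrt (\<lambda>a b. allowed a b (Suc n)) A"
    by (rule sorted_wrt_mono_rel[OF _ assms(2)]) (use le in \<open>force simp: allowed_def\<close>)
  ultimately show ?thesis
    using *(2) le by (fastforce simp: stirling_perms_123_iff avoid3_append allowed_def)
qed

text \<open>The copies of the maximum are adjacent because a letter between them would have to be
  larger. An ascent in front of them would extend to a 123 pattern.\<close>

lemma stirling_perms_123_SucE:
  assumes "\<tau> \<in> stirling_perms_123 (Suc n)"
  obtains A B where "\<tau> = A @ [Suc n, Suc n] @ B" "A @ B \<in> stirling_perms_123 n"
    "sorted_wrt (\<ge>) A"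
proof -
  let ?N = "Suc n"
  have m: "mset \<tau> = mset_set {1..n} + mset_set {1..n} + {#?N, ?N#}" and av: "avoid3 allowed \<tau>"
    using assms by (auto simp: stirling_perms_123_iff atLeastAtMostSuc_conv)
  have s: "set \<tau> = {1..?N}" using set_stirling_perms_123[OF assms] .
  then obtain A C where AC: "\<tau> = A @ ?N # C" "?N \<notin> set A"
    using split_list_first[of ?N \<tau>] by auto
  have "count (mset \<tau>) ?N = 2" unfolding m by simp
  then have "count (mset C) ?N = 1" using AC by (simp add: count_mset_0_iff[THEN iffD2])
  then have "?N \<in> set C" by (metis count_mset_0_iff zero_neq_one)
  then obtain D B where DB: "C = D @ ?N # B" by (meson split_list)
  have "D = []"
  proof (rule ccontr)
    assume "D \<noteq> []"
    then obtain d where d: "d \<in> set D" by (cases D) auto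
    have "sorted_wrt (allowed ?N) (D @ ?N # B)"
      using av unfolding AC(1) DB avoid3_append avoid3.simps by blast
    then have "allowed ?N d ?N" using d unfolding sorted_wrt_append by simp
    moreover have "d \<in> set \<tau>" using d unfolding AC(1) DB by simp
    then have "d \<le> ?N" unfolding s by simp
    ultimately show False by (simp add: allowed_def)
  qed
  then have t: "\<tau> = A @ [?N, ?N] @ B" using AC DB by simp
  have "mset (A @ B) = mset_set {1..n} + mset_set {1..n}" using m t by simp
  moreover have "avoid3 allowed (A @ B)" using av unfolding t by (auto simp: avoid3_append)
  ultimately have AB: "A @ B \<in> stirling_perms_123 n" by (simp add: stirling_perms_123_iff)
  have "sorted_wrt (\<lambda>a b. allowed a b ?N) A" using av unfolding t by (auto simp: avoid3_append)
  moreover have "x < ?N" if "x \<in> set A" for x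
    using set_stirling_perms_123[OF AB] that atLeastAtMost_iff[of x 1 n]
    by (auto simp del: atLeastAtMost_iff)
  ultimately have "sorted_wrt (\<ge>) A"
    by (elim sorted_wrt_mono_rel[rotated]) (auto simp: allowed_def not_less)
  then show ?thesis using that t AB by blast
qed

definition ins :: "nat \<Rightarrow> nat \<Rightarrow> nat list \<Rightarrow> nat list" where
  "ins j N \<tau> = take j \<tau> @ [N, N] @ drop j \<tau>"

text \<open>Words carry a trailing \<open>0\<close> below; nothing may be inserted behind it.\<close>

definition slots :: "nat list \<Rightarrow> nat set" where
  "slots \<tau> = {j. j < length \<tau> \<and> sorted_wrt (\<ge>) (take j \<tau>)}"

lemma finite_slots: "finite (slots \<tau>)"
  by (simp add: slots_def)

lemma bij_betw_ins:
  "bij_betw (\<lambda>(\<sigma>, j). ins j (Suc n) \<sigma>) (SIGMA \<sigma>:stirling_perms_123 n. slots (\<sigma> @ [0]))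
     (stirling_perms_123 (Suc n))"
proof (rule bij_betw_imageI)
  show "inj_on (\<lambda>(\<sigma>, j). ins j (Suc n) \<sigma>) (SIGMA \<sigma>:stirling_perms_123 n. slots (\<sigma> @ [0]))"
  proof (rule inj_onI, clarify)
    fix \<sigma> j \<sigma>' j'
    assume *: "\<sigma> \<in> stirling_perms_123 n" "\<sigma>' \<in> stirling_perms_123 n"
      "j \<in> slots (\<sigma> @ [0])" "j' \<in> slots (\<sigma>' @ [0])"
      and eq: "ins j (Suc n) \<sigma> = ins j' (Suc n) \<sigma>'"
    have N: "\<And>x. x \<in> set \<sigma> \<Longrightarrow> x \<noteq> Suc n" "\<And>x. x \<in> set \<sigma>' \<Longrightarrow> x \<noteq> Suc n"
      using *(1,2)[THEN set_stirling_perms_123] by auto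
    \<comment> \<open>The pair is recovered from the word: the prefix before the first
      \<open>Suc n\<close> gives the slot, deletion of \<open>Suc n\<close> gives
      \<open>\<sigma>\<close>.\<close>
    have tW: "takeWhile (\<lambda>x. x \<noteq> Suc n) (ins i (Suc n) s) = take i s"
      if "\<And>x. x \<in> set s \<Longrightarrow> x \<noteq> Suc n" for i s
      using that unfolding ins_def by (subst takeWhile_append2) (auto dest: in_set_takeD)
    have fl: "filter (\<lambda>x. x \<noteq> Suc n) (ins i (Suc n) s) = s"
      if "\<And>x. x \<in> set s \<Longrightarrow> x \<noteq> Suc n" for i s
    proof -
      have "filter (\<lambda>x. x \<noteq> Suc n) (ins i (Suc n) s) = filter (\<lambda>x. x \<noteq> Suc n) (take i s @ drop i s)"
        unfolding ins_def by (simp only: filter_append) simp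
      also have "\<dots> = s" using that by (simp only: append_take_drop_id) (simp add: filter_id_conv)
      finally show ?thesis .
    qed
    have "take j \<sigma> = take j' \<sigma>'" using tW[OF N(1)] tW[OF N(2)] eq by metis
    moreover have "\<sigma> = \<sigma>'" using fl[OF N(1)] fl[OF N(2)] eq by metis
    \<comment> \<open>A slot of the word with its trailing \<open>0\<close> is at most the length of
      \<open>\<sigma>\<close>; beyond that, \<open>take j\<close> would not determine
      \<open>j\<close>.\<close>
    moreover have "j \<le> length \<sigma>" "j' \<le> length \<sigma>'" using * by (auto simp: slots_def)
    ultimately show "\<sigma> = \<sigma>' \<and> j = j'" by (metis length_take min.absorb2)
  qed
  show "(\<lambda>(\<sigma>, j). ins j (Suc n) \<sigma>) ` (SIGMA \<sigma>:stirling_perms_123 n. slots (\<sigma> @ [0])) =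
          stirling_perms_123 (Suc n)"
  proof (intro equalityI subsetI)
    fix \<tau> assume "\<tau> \<in> stirling_perms_123 (Suc n)"
    then obtain A B where AB: "\<tau> = A @ [Suc n, Suc n] @ B" "A @ B \<in> stirling_perms_123 n"
      "sorted_wrt (\<ge>) A" by (rule stirling_perms_123_SucE)
    then have "\<tau> = ins (length A) (Suc n) (A @ B)" "length A \<in> slots ((A @ B) @ [0])"
      by (auto simp: ins_def slots_def)
    then show "\<tau> \<in> (\<lambda>(\<sigma>, j). ins j (Suc n) \<sigma>) `
        (SIGMA \<sigma>:stirling_perms_123 n. slots (\<sigma> @ [0]))"
      using AB(2) by force
  next
    fix \<tau> assume "\<tau> \<in> (\<lambda>(\<sigma>, j). ins j (Suc n) \<sigma>) `
        (SIGMA \<sigma>:stirling_perms_123 n. slots (\<sigma> @ [0]))"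
    then obtain \<sigma> j where "\<sigma> \<in> stirling_perms_123 n" "j \<in> slots (\<sigma> @ [0])"
      "\<tau> = ins j (Suc n) \<sigma>" by auto
    then show "\<tau> \<in> stirling_perms_123 (Suc n)"
      using insert_max_stirling_perms_123[of "take j \<sigma>" "drop j \<sigma>" n]
      by (auto simp: slots_def ins_def)
  qed
qed

lemma sum_stirling_perms_123_Suc:
  fixes F :: "nat list \<Rightarrow> 'a::comm_monoid_add"
  shows "(\<Sum>\<sigma>\<in>stirling_perms_123 (Suc n). F (\<sigma> @ [0])) =
    (\<Sum>\<sigma>\<in>stirling_perms_123 n. \<Sum>j\<in>slots (\<sigma> @ [0]). F (ins j (Suc n) (\<sigma> @ [0])))"
proof -
  have "(\<Sum>\<sigma>\<in>stirling_perms_123 (Suc n). F (\<sigma> @ [0])) =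
     (\<Sum>(\<sigma>, j)\<in>(SIGMA \<sigma>:stirling_perms_123 n. slots (\<sigma> @ [0])). F (ins j (Suc n) \<sigma> @ [0]))"
    by (subst sum.reindex_bij_betw[OF bij_betw_ins, symmetric]) (simp add: case_prod_unfold)
  \<comment> \<open>Insertion commutes with appending \<open>0\<close> because no slot lies behind
    the \<open>0\<close>.\<close>
  also have "\<dots> = (\<Sum>(\<sigma>, j)\<in>(SIGMA \<sigma>:stirling_perms_123 n. slots (\<sigma> @ [0])).
      F (ins j (Suc n) (\<sigma> @ [0])))"
    by (rule sum.cong) (auto simp: ins_def slots_def)
  finally show ?thesis
    by (simp add: sum.Sigma finite_stirling_perms_123 finite_slots)
qed

section \<open>Initial runs and their change under insertion\<close>

definition alternating_run :: "nat \<Rightarrow> nat list \<Rightarrow> bool" where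
  "alternating_run k \<tau> \<longleftrightarrow> (\<forall>i. Suc i < k \<longrightarrow>
     (if even i then \<tau> ! Suc i = \<tau> ! i else \<tau> ! Suc i < \<tau> ! i))"

definition ascent_run :: "nat \<Rightarrow> nat list \<Rightarrow> bool" where
  "ascent_run k \<tau> \<longleftrightarrow> 0 < k \<and> k < length \<tau> \<and> alternating_run k \<tau> \<and> \<tau> ! (k - 1) < \<tau> ! k"

text \<open>Here \<open>k\<close> counts the letters before the trailing \<open>0\<close>, so that
  in both kinds of run the slots are exactly \<open>0\<close> to \<open>k\<close>.\<close>

definition full_run :: "nat \<Rightarrow> nat list \<Rightarrow> bool" where
  "full_run k \<tau> \<longleftrightarrow> length \<tau> = Suc k \<and> alternating_run (Suc k) \<tau>"

lemma sorted_take_alternating_run: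
  assumes "alternating_run k \<tau>" "j \<le> k" "k \<le> length \<tau>"
  shows "sorted_wrt (\<ge>) (take j \<tau>)"
proof -
  have "transp ((\<ge>) :: nat \<Rightarrow> nat \<Rightarrow> bool)" by (auto simp: transp_def)
  moreover have "\<tau> ! Suc i \<le> \<tau> ! i" if "Suc i < j" for i
    using assms that unfolding alternating_run_def
    by (metis less_le_trans less_or_eq_imp_le order_refl)
  ultimately show ?thesis
    using assms by (auto simp: sorted_wrt_iff_nth_Suc_transp)
qed

text \<open>A prefix longer than \<open>k\<close> contains the ascent from position
  \<open>k - 1\<close> to \<open>k\<close>; a shorter one lies within the run.\<close>

lemma slots_ascent_run:
  assumes "ascent_run k \<tau>" shows "slots \<tau> = {0..k}"
proof -
  have "j \<le> k" if j: "j < length \<tau>" "sorted_wrt (\<ge>) (take j \<tau>)" for j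
  proof (rule ccontr)
    assume "\<not> j \<le> k"
    then have "take j \<tau> ! (k - 1) \<ge> take j \<tau> ! k"
      using assms j by (intro sorted_wrt_nth_less[OF j(2)]) (auto simp: ascent_run_def)
    then show False using assms \<open>\<not> j \<le> k\<close> by (auto simp: ascent_run_def)
  qed
  then show ?thesis
    using assms sorted_take_alternating_run[of k \<tau>] by (auto simp: slots_def ascent_run_def)
qed

lemma slots_full_run: "full_run k \<tau> \<Longrightarrow> slots \<tau> = {0..k}"
  using sorted_take_alternating_run[of "Suc k" \<tau>] by (auto simp: slots_def full_run_def)

text \<open>The new pair contributes a plateau and a descent and moves the old pattern by two
  positions, which keeps the parities.\<close>

lemma alternating_run_ins_0:
  assumes "alternating_run k \<tau>" "\<tau> \<noteq> []" "\<forall>x\<in>set \<tau>. x < N"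
  shows "alternating_run (Suc (Suc k)) (ins 0 N \<tau>)"
  unfolding alternating_run_def
proof (intro allI impI)
  fix i assume i: "Suc i < Suc (Suc k)"
  have N: "\<tau> ! 0 < N" using assms by (cases \<tau>) auto
  consider "i = 0" | "i = 1" | i' where "i = Suc (Suc i')"
    by (metis One_nat_def not0_implies_Suc)
  then show "if even i then ins 0 N \<tau> ! Suc i = ins 0 N \<tau> ! i
      else ins 0 N \<tau> ! Suc i < ins 0 N \<tau> ! i"
  proof cases
    case (3 i')
    then have "Suc i' < k" using i by simp
    then show ?thesis using assms(1) 3 by (simp add: ins_def alternating_run_def)
  qed (use N in \<open>simp_all add: ins_def\<close>)
qed

lemma ascent_run_ins_0:
  assumes "ascent_run k \<tau>" "\<forall>x\<in>set \<tau>. x < N"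
  shows "ascent_run (k + 2) (ins 0 N \<tau>)"
proof -
  have "\<tau> \<noteq> []" using assms by (auto simp: ascent_run_def)
  then show ?thesis
    using assms alternating_run_ins_0[of k \<tau> N]
    by (cases k) (auto simp: ascent_run_def ins_def)
qed

lemma full_run_ins_0:
  assumes "full_run k \<tau>" "\<forall>x\<in>set \<tau>. x < N"
  shows "full_run (k + 2) (ins 0 N \<tau>)"
proof -
  have "\<tau> \<noteq> []" using assms by (auto simp: full_run_def)
  then show ?thesis
    using assms alternating_run_ins_0[of "Suc k" \<tau> N] by (auto simp: full_run_def ins_def)
qed

text \<open>The kept prefix still alternates, and the step up to \<open>N\<close> now ends the run,
  whatever followed before. This also turns a full run into an ascent run.\<close>

lemma ascent_run_ins:
  assumes "alternating_run k \<tau>" "0 < j" "j \<le> k" "j < length \<tau>" "\<forall>x\<in>set \<tau>. x < N"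
  shows "ascent_run j (ins j N \<tau>)"
  using assms by (auto simp: ascent_run_def alternating_run_def ins_def nth_append)

lemma set_ins: "set (ins j N \<tau>) = insert N (set \<tau>)"
proof -
  have "set (ins j N \<tau>) = insert N (set (take j \<tau> @ drop j \<tau>))"
    unfolding ins_def by (simp only: set_append) auto
  then show ?thesis by (simp only: append_take_drop_id)
qed

section \<open>Weights of words and of insertions\<close>

context
  fixes p q r :: "'a::comm_ring_1"
begin

definition step :: "nat \<Rightarrow> nat \<Rightarrow> 'a" where
  "step a b = (if a = b then p else if b < a then q else r)"

fun wt :: "nat list \<Rightarrow> 'a" where
  "wt (a # b # xs) = step a b * wt (b # xs)"
| "wt _ = 1"

lemma wt_append:
  "xs \<noteq> [] \<Longrightarrow> ys \<noteq> [] \<Longrightarrow> wt (xs @ ys) = wt xs * step (last xs) (hd ys) * wt ys"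
proof (induction xs rule: wt.induct)
  case ("2_2" v)
  then show ?case by (cases ys) auto
qed (auto simp: mult.assoc)

lemma card_adjacent_Cons:
  "card {i. Suc i < length (a # b # xs) \<and> R ((a # b # xs) ! i) ((a # b # xs) ! Suc i)} =
   (if R a b then 1 else 0) +
   card {i. Suc i < length (b # xs) \<and> R ((b # xs) ! i) ((b # xs) ! Suc i)}"
proof -
  let ?S = "{i. Suc i < length (b # xs) \<and> R ((b # xs) ! i) ((b # xs) ! Suc i)}"
  have "{i. Suc i < length (a # b # xs) \<and> R ((a # b # xs) ! i) ((a # b # xs) ! Suc i)} =
      (if R a b then {0} else {}) \<union> Suc ` ?S"
    (is "?T = ?U")
  proof (rule set_eqI)
    fix i show "i \<in> ?T \<longleftrightarrow> i \<in> ?U" by (cases i) auto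
  qed
  moreover have "finite ?S" by (rule finite_subset[of _ "{..length xs}"]) auto
  ultimately show ?thesis by (simp add: card_image)
qed

lemma wt_eq: "wt \<sigma> = p ^ plat \<sigma> * q ^ des \<sigma> * r ^ asc \<sigma>"
proof (induction \<sigma> rule: wt.induct)
  case (1 a b xs)
  have "plat (a # b # xs) = (if a = b then 1 else 0) + plat (b # xs)"
    "des (a # b # xs) = (if b < a then 1 else 0) + des (b # xs)"
    "asc (a # b # xs) = (if a < b then 1 else 0) + asc (b # xs)"
    unfolding plat_def des_def asc_def
    by (rule card_adjacent_Cons[of a b xs "(=)"] card_adjacent_Cons[of a b xs "(>)"]
        card_adjacent_Cons[of a b xs "(<)"])+
  then show ?case using 1 by (auto simp: step_def algebra_simps)
qed (auto simp: plat_def des_def asc_def)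

lemma wt_split:
  assumes "0 < j" "j < length \<tau>"
  shows "wt \<tau> = wt (take j \<tau>) * step (\<tau> ! (j - 1)) (\<tau> ! j) * wt (drop j \<tau>)"
proof -
  have "\<tau> \<noteq> []" using assms by auto
  then show ?thesis
    using wt_append[of "take j \<tau>" "drop j \<tau>"] assms
    by (simp add: last_conv_nth hd_drop_conv_nth min_def)
qed

lemma wt_ins_0: "\<tau> \<noteq> [] \<Longrightarrow> \<forall>x\<in>set \<tau>. x < N \<Longrightarrow> wt (ins 0 N \<tau>) = p * q * wt \<tau>"
  by (cases \<tau>) (auto simp: ins_def step_def)

lemma wt_ins:
  assumes "0 < j" "j < length \<tau>" "\<forall>x\<in>set \<tau>. x < N"
  shows "wt (ins j N \<tau>) = wt (take j \<tau>) * (p * q * r) * wt (drop j \<tau>)"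
proof -
  have ne: "take j \<tau> \<noteq> []" "drop j \<tau> \<noteq> []" using assms by auto
  have "last (take j \<tau>) < N" using ne assms(3) by (meson in_set_takeD last_in_set)
  moreover have "wt ([N, N] @ drop j \<tau>) = p * q * wt (drop j \<tau>)"
    using wt_ins_0[OF ne(2), of N] assms(3) by (auto simp: ins_def dest: in_set_dropD)
  ultimately show ?thesis
    unfolding ins_def using wt_append[of "take j \<tau>" "[N, N] @ drop j \<tau>"] ne
    by (simp add: step_def algebra_simps)
qed

text \<open>Insertion at an inner gap replaces one step by ascent, plateau and descent, of weight
  \<open>p * q * r\<close>. The old step is \<open>p\<close> at odd \<open>j\<close> and
  \<open>q\<close> at even \<open>j\<close>; the quotient is written out since the ring need not
  allow division.\<close>

definition gap_wt :: "nat \<Rightarrow> 'a" where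
  "gap_wt j = (if odd j then q * r else p * r)"

lemma wt_ins_run:
  assumes "alternating_run k \<tau>" "0 < j" "j < k" "j < length \<tau>" "\<forall>x\<in>set \<tau>. x < N"
  shows "wt (ins j N \<tau>) = gap_wt j * wt \<tau>"
proof -
  obtain i where i: "j = Suc i" using assms(2) by (cases j) auto
  \<comment> \<open>The gap \<open>j\<close> follows position \<open>i = j - 1\<close>, so its
    parity is opposite to the one in \<open>alternating_run\<close>.\<close>
  then have "step (\<tau> ! (j - 1)) (\<tau> ! j) = (if odd j then p else q)"
    using assms(1,3) by (fastforce simp: alternating_run_def step_def split: if_splits)
  then show ?thesis
    using wt_ins[OF assms(2,4,5)] wt_split[OF assms(2,4)] by (simp add: gap_wt_def mult_ac)
qed

text \<open>The replaced step is the ascent ending the run, so the factor \<open>r\<close> is lost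
  and regained.\<close>

lemma wt_ins_ascent:
  assumes "ascent_run k \<tau>" "\<forall>x\<in>set \<tau>. x < N"
  shows "wt (ins k N \<tau>) = p * q * wt \<tau>"
  using assms wt_ins[of k \<tau> N] wt_split[of k \<tau>] by (simp add: ascent_run_def step_def mult_ac)

section \<open>Descendants counted by run length\<close>

primrec g :: "nat \<Rightarrow> nat \<Rightarrow> 'a" where
  "g 0 k = 1"
| "g (Suc m) k = p * q * g m (k + 2) + (\<Sum>j=1..<k. gap_wt j * g m j) + p * q * g m k"

text \<open>In contrast to \<open>g\<close>, the sum includes \<open>j = k\<close>: the gap before
  the trailing \<open>0\<close> is an inner gap of the run, not an ascent.\<close>

primrec h :: "nat \<Rightarrow> nat \<Rightarrow> 'a" where
  "h 0 k = 1"
| "h (Suc m) k = p * q * h m (k + 2) + (\<Sum>j=1..k. gap_wt j * g m j)"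

primrec desc_sum :: "nat \<Rightarrow> nat \<Rightarrow> nat list \<Rightarrow> 'a" where
  "desc_sum 0 N \<tau> = wt \<tau>"
| "desc_sum (Suc m) N \<tau> = (\<Sum>j\<in>slots \<tau>. desc_sum m (Suc N) (ins j N \<tau>))"

text \<open>Each induction step trades one generation of the index set for one more round of
  insertions, hence the arbitrary \<open>m\<close>. All words thus descend from
  \<open>[0]\<close>.\<close>

lemma sum_desc_sum:
  "(\<Sum>\<sigma>\<in>stirling_perms_123 n. desc_sum m (Suc n) (\<sigma> @ [0])) = desc_sum (m + n) 1 [0]"
proof (induction n arbitrary: m)
  case 0
  show ?case by (simp add: stirling_perms_123_0)
next
  case (Suc n)
  show ?case
    using Suc.IH[of "Suc m"] by (simp add: sum_stirling_perms_123_Suc[of "desc_sum m (Suc (Suc n))"])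
qed

lemma desc_sum_ascent_run:
  "ascent_run k \<tau> \<Longrightarrow> \<forall>x\<in>set \<tau>. x < N \<Longrightarrow> desc_sum m N \<tau> = wt \<tau> * g m k"
proof (induction m arbitrary: k N \<tau>)
  case (Suc m)
  have k: "0 < k" "k < length \<tau>" "alternating_run k \<tau>" using Suc.prems by (auto simp: ascent_run_def)
  have N: "\<forall>x\<in>set (ins j N \<tau>). x < Suc N" for j using Suc.prems(2) by (auto simp: set_ins)
  have "\<tau> \<noteq> []" using k by auto
  then have 0: "desc_sum m (Suc N) (ins 0 N \<tau>) = wt \<tau> * (p * q * g m (k + 2))"
    using Suc.IH[OF ascent_run_ins_0[OF Suc.prems] N] wt_ins_0[of \<tau> N] Suc.prems(2)
    by (simp add: mult_ac)
  have *: "desc_sum m (Suc N) (ins j N \<tau>) = wt (ins j N \<tau>) * g m j" if "0 < j" "j \<le> k" for j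
    using Suc.IH[OF ascent_run_ins[OF k(3) that _ Suc.prems(2)] N] that k by simp
  \<comment> \<open>The front, the end of the run and the inner gaps yield the three terms in the
    recursion of \<open>g\<close>.\<close>
  have "{0..k} = insert 0 (insert k {1..<k})" using k by auto
  then have "desc_sum (Suc m) N \<tau> = desc_sum m (Suc N) (ins 0 N \<tau>) +
      (desc_sum m (Suc N) (ins k N \<tau>) + (\<Sum>j=1..<k. desc_sum m (Suc N) (ins j N \<tau>)))"
    using k by (simp add: slots_ascent_run[OF Suc.prems(1)])
  also have "(\<Sum>j=1..<k. desc_sum m (Suc N) (ins j N \<tau>)) =
      wt \<tau> * (\<Sum>j=1..<k. gap_wt j * g m j)"
    unfolding sum_distrib_left
    using * k Suc.prems(2) by (intro sum.cong) (auto simp: wt_ins_run mult_ac)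
  finally show ?case
    using 0 * k wt_ins_ascent[OF Suc.prems] by (simp add: algebra_simps)
qed simp

lemma desc_sum_full_run:
  "full_run k \<tau> \<Longrightarrow> \<forall>x\<in>set \<tau>. x < N \<Longrightarrow> desc_sum m N \<tau> = wt \<tau> * h m k"
proof (induction m arbitrary: k N \<tau>)
  case (Suc m)
  have k: "length \<tau> = Suc k" "alternating_run (Suc k) \<tau>" using Suc.prems by (auto simp: full_run_def)
  have N: "\<forall>x\<in>set (ins j N \<tau>). x < Suc N" for j using Suc.prems(2) by (auto simp: set_ins)
  have 0: "desc_sum m (Suc N) (ins 0 N \<tau>) = wt \<tau> * (p * q * h m (k + 2))"
    using Suc.IH[OF full_run_ins_0[OF Suc.prems] N] wt_ins_0[of \<tau> N] k Suc.prems(2)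
    by (cases \<tau>) (auto simp: mult_ac)
  have *: "desc_sum m (Suc N) (ins j N \<tau>) = wt \<tau> * (gap_wt j * g m j)" if "0 < j" "j \<le> k" for j
    using desc_sum_ascent_run[OF ascent_run_ins[OF k(2) that(1) _ _ Suc.prems(2)] N]
      wt_ins_run[OF k(2) that(1) _ _ Suc.prems(2)] that k by (simp add: mult_ac)
  have "{0..k} = insert 0 {1..k}" by auto
  then have "desc_sum (Suc m) N \<tau> = desc_sum m (Suc N) (ins 0 N \<tau>) +
      (\<Sum>j=1..k. desc_sum m (Suc N) (ins j N \<tau>))"
    by (simp add: slots_full_run[OF Suc.prems(1)])
  also have "(\<Sum>j=1..k. desc_sum m (Suc N) (ins j N \<tau>)) =
      wt \<tau> * (\<Sum>j=1..k. gap_wt j * g m j)"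
    unfolding sum_distrib_left using * by (intro sum.cong) auto
  finally show ?case
    using 0 by (simp add: algebra_simps)
qed simp

lemma sum_wt_trailing_0: "(\<Sum>\<sigma>\<in>stirling_perms_123 n. wt (\<sigma> @ [0])) = h n 0"
proof -
  have "full_run 0 [0]" by (simp add: full_run_def alternating_run_def)
  then show ?thesis
    using sum_desc_sum[of 0 n] desc_sum_full_run[of 0 "[0]" 1 n] by simp
qed

section \<open>Generating functions and the shift by two\<close>

definition G :: "nat \<Rightarrow> 'a fps" where "G k = Abs_fps (\<lambda>m. g m k)"

definition H :: "nat \<Rightarrow> 'a fps" where "H k = Abs_fps (\<lambda>m. h m k)"

text \<open>The trailing \<open>0\<close> gives every nonempty word a final descent, hence a factor
  \<open>q\<close>. The empty word gains none, and \<open>- q + 1\<close> corrects the constant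
  coefficient.\<close>

lemma C123_eq_H: "fps_const q * C123 p q r - fps_const q + 1 = H 0"
proof (rule fps_ext)
  fix n
  show "fps_nth (fps_const q * C123 p q r - fps_const q + 1) n = fps_nth (H 0) n"
  proof (cases n)
    case 0
    then show ?thesis
      by (simp add: C123_def H_def stirling_perms_123_0 plat_def des_def asc_def)
  next
    case (Suc n')
    have "wt (\<sigma> @ [0]) = q * wt \<sigma>" if "\<sigma> \<in> stirling_perms_123 n" for \<sigma>
    proof -
      have s: "set \<sigma> = {1..n}" using that by (rule set_stirling_perms_123)
      then have "\<sigma> \<noteq> []" using Suc by auto
      moreover have "last \<sigma> > 0" using s calculation last_in_set[of \<sigma>] by auto
      ultimately show ?thesis using wt_append[of \<sigma> "[0]"] by (simp add: step_def mult.commute)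
    qed
    then show ?thesis
      using Suc sum_wt_trailing_0[of n]
      by (simp add: C123_def H_def sum_distrib_left flip: wt_eq)
  qed
qed

lemma G_eq: "G k = 1 + fps_X * (fps_const (p * q) * G (k + 2) +
    (\<Sum>j=1..<k. fps_const (gap_wt j) * G j) + fps_const (p * q) * G k)"
proof (rule fps_ext)
  fix n show "fps_nth (G k) n = fps_nth (1 + fps_X * (fps_const (p * q) * G (k + 2) +
    (\<Sum>j=1..<k. fps_const (gap_wt j) * G j) + fps_const (p * q) * G k)) n"
    by (cases n) (simp_all add: G_def fps_sum_nth)
qed

lemma H_eq: "H k = 1 + fps_X * (fps_const (p * q) * H (k + 2) +
    (\<Sum>j=1..k. fps_const (gap_wt j) * G j))"
proof (rule fps_ext)
  fix n show "fps_nth (H k) n = fps_nth (1 + fps_X * (fps_const (p * q) * H (k + 2) +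
    (\<Sum>j=1..k. fps_const (gap_wt j) * G j))) n"
    by (cases n) (simp_all add: H_def G_def fps_sum_nth)
qed

definition growth :: "'a fps" where
  "growth = 1 + fps_X * (fps_const (q * r) * G 1 + fps_const (p * r) * G 2)"

text \<open>\<open>gap_wt\<close> has period 2, so after splitting off the first two terms, those
  occurring in \<open>growth\<close>, the weights are the old ones. For \<open>0 < k\<close> both
  terms are in range.\<close>

lemma sum_gap_shift:
  assumes "0 < k"
  shows "(\<Sum>j=1..<k + 2. fps_const (gap_wt j) * G j) =
    fps_const (q * r) * G 1 + fps_const (p * r) * G 2 +
    (\<Sum>j=1..<k. fps_const (gap_wt j) * G (j + 2))"
proof -
  have "{1..<k + 2} = insert 1 (insert 2 {3..<k + 2})" using assms by auto
  moreover have "(\<Sum>j=3..<k + 2. fps_const (gap_wt j) * G j) =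
      (\<Sum>j=1..<k. fps_const (gap_wt (j + 2)) * G (j + 2))"
    using sum.shift_bounds_nat_ivl[of "\<lambda>j. fps_const (gap_wt j) * G j" 1 2 k]
    by (simp add: numeral_3_eq_3)
  moreover have "gap_wt (j + 2) = gap_wt j" for j by (simp add: gap_wt_def)
  ultimately show ?thesis by (simp add: gap_wt_def algebra_simps)
qed

text \<open>The shift turns the inhomogeneous term 1 of the system into \<open>growth\<close>, so
  the difference \<open>E\<close> of the two sides solves the homogeneous system.\<close>

lemma G_add_2:
  assumes "0 < k"
  shows "G (k + 2) = growth * G k"
proof -
  define E where "E k = G (k + 2) - growth * G k" for k
  have E: "E k = fps_X * (fps_const (p * q) * E (k + 2) +
    (\<Sum>j=1..<k. fps_const (gap_wt j) * E j) + fps_const (p * q) * E k)" if "0 < k" for k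
  proof -
    have "E k = 1 + fps_X * (fps_const (p * q) * G (k + 2 + 2) +
        (\<Sum>j=1..<k + 2. fps_const (gap_wt j) * G j) + fps_const (p * q) * G (k + 2)) -
      growth * (1 + fps_X * (fps_const (p * q) * G (k + 2) +
        (\<Sum>j=1..<k. fps_const (gap_wt j) * G j) + fps_const (p * q) * G k))"
      by (simp only: E_def G_eq[symmetric])
    also have "\<dots> = fps_X * (fps_const (p * q) * (G (k + 2 + 2) - growth * G (k + 2)) +
        ((\<Sum>j=1..<k. fps_const (gap_wt j) * G (j + 2)) -
         growth * (\<Sum>j=1..<k. fps_const (gap_wt j) * G j)) +
        fps_const (p * q) * (G (k + 2) - growth * G k))"
      unfolding sum_gap_shift[OF that] by (simp add: growth_def algebra_simps)
    also have "(\<Sum>j=1..<k. fps_const (gap_wt j) * G (j + 2)) -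
         growth * (\<Sum>j=1..<k. fps_const (gap_wt j) * G j) =
        (\<Sum>j=1..<k. fps_const (gap_wt j) * E j)"
      by (simp add: E_def sum_distrib_left sum_subtractf algebra_simps)
    finally show ?thesis unfolding E_def .
  qed
  \<comment> \<open>The factor \<open>fps_X\<close> expresses coefficient \<open>Suc n\<close> of
    \<open>E k\<close> by coefficients \<open>n\<close> of other members of the family, so all
    \<open>k\<close> are treated at once.\<close>
  have "0 < k \<Longrightarrow> fps_nth (E k) n = 0" for n k
  proof (induction n arbitrary: k)
    case 0
    then show ?case by (subst E) auto
  next
    case (Suc n)
    then show ?case by (subst E) (auto simp: fps_sum_nth)
  qed
  then have "E k = 0" using assms by (intro fps_ext) simp
  then show ?thesis by (simp add: E_def)
qed

lemma H_add_2: "H (k + 2) = growth * H k"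
proof -
  define E where "E k = H (k + 2) - growth * H k" for k
  have E: "E k = fps_X * (fps_const (p * q) * E (k + 2))" for k
  proof -
    \<comment> \<open>By \<open>G_add_2\<close> the inhomogeneous part scales by
      \<open>growth\<close> too. The bound \<open>Suc k\<close> lets \<open>sum_gap_shift\<close>
      apply even for \<open>k = 0\<close>.\<close>
    have "(\<Sum>j=1..<Suc k. fps_const (gap_wt j) * G (j + 2)) =
        growth * (\<Sum>j=1..<Suc k. fps_const (gap_wt j) * G j)"
      unfolding sum_distrib_left by (rule sum.cong) (auto simp: G_add_2[simplified] mult_ac)
    then have S: "(\<Sum>j=1..k + 2. fps_const (gap_wt j) * G j) =
        fps_const (q * r) * G 1 + fps_const (p * r) * G 2 +
        growth * (\<Sum>j=1..k. fps_const (gap_wt j) * G j)"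
      using sum_gap_shift[of "Suc k"] by (simp add: atLeastLessThanSuc_atLeastAtMost)
    have "E k = 1 + fps_X * (fps_const (p * q) * H (k + 2 + 2) +
        (\<Sum>j=1..k + 2. fps_const (gap_wt j) * G j)) -
      growth * (1 + fps_X * (fps_const (p * q) * H (k + 2) +
        (\<Sum>j=1..k. fps_const (gap_wt j) * G j)))"
      by (simp only: E_def H_eq[symmetric])
    then show ?thesis
      unfolding S E_def by (simp add: growth_def algebra_simps)
  qed
  have "fps_nth (E k) n = 0" for n k
  proof (induction n arbitrary: k)
    case 0
    then show ?case by (subst E) auto
  next
    case (Suc n)
    then show ?case by (subst E) auto
  qed
  then have "E k = 0" by (intro fps_ext) simp
  then show ?thesis by (simp add: E_def)
qed

section \<open>Elimination of the auxiliary series\<close>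

lemma growth_elimination:
  fixes t u v L f g1 g2 :: "'b::comm_ring_1"
  assumes "g1 = 1 + (t * L * g1 + t * g1)" "g2 = 1 + u * g1 + (t * L * g2 + t * g2)"
    "L = 1 + u * g1 + v * g2" "f = 1 + t * L * f"
  shows "(f - 1) * (1 - t * f)\<^sup>2 = t * f * (1 - t * f + u * f) * (1 - t * f + v * f)"
proof -
  \<comment> \<open>\<open>K\<close> is the common coefficient of \<open>g1\<close> and
    \<open>g2\<close> once their equations are solved for the remaining terms; the equation for
    \<open>f\<close> gives \<open>K * f = 1 - t * f\<close>.\<close>
  define K where "K = 1 - t - t * L"
  have "K * g1 = g1 - (t * L * g1 + t * g1)" by (simp add: K_def algebra_simps)
  also have "\<dots> = 1" using assms(1) by (simp only: diff_eq_eq)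
  finally have K1: "K * g1 = 1" .
  have "K * g2 = g2 - (t * L * g2 + t * g2)" by (simp add: K_def algebra_simps)
  also have "\<dots> = 1 + u * g1" using assms(2) by (simp only: diff_eq_eq)
  finally have K2: "K * g2 = 1 + u * g1" .
  have f1: "f - 1 = t * L * f" using assms(4) by (simp only: diff_eq_eq add.commute)
  have "K * f = f - t * L * f - t * f" by (simp add: K_def algebra_simps)
  then have Kf: "1 - t * f = K * f" unfolding f1[symmetric] by simp
  \<comment> \<open>One factor \<open>K\<close> clears \<open>g1\<close>; two are needed for
    \<open>g2\<close>, whose equation contains \<open>g1\<close>. A later factor
    \<open>f\<^sup>2\<close> replaces \<open>K\<close> by \<open>1 - t * f\<close>, all without
    division.\<close>
  have "L * K\<^sup>2 = K\<^sup>2 + u * K * (K * g1) + v * K * (K * g2)"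
    unfolding assms(3) by (simp add: algebra_simps power2_eq_square)
  also have "\<dots> = K\<^sup>2 + u * K * (K * g1) + v * K + u * v * (K * g1)"
    unfolding K2 by (simp add: algebra_simps)
  finally have LK: "L * K\<^sup>2 = (K + u) * (K + v)"
    unfolding K1 by (simp add: algebra_simps power2_eq_square)
  have "(f - 1) * (1 - t * f)\<^sup>2 = t * f * (L * K\<^sup>2) * f\<^sup>2"
    unfolding f1 Kf by (simp add: algebra_simps power_mult_distrib)
  also have "\<dots> = t * f * (K * f + u * f) * (K * f + v * f)"
    unfolding LK by (simp add: algebra_simps power2_eq_square)
  finally show ?thesis unfolding Kf .
qed

text \<open>The shift relations rewrite \<open>G 3\<close>, \<open>G 4\<close> and
  \<open>H 2\<close>, so the infinite system closes on \<open>G 1\<close>, \<open>G 2\<close>,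
  \<open>growth\<close> and \<open>H 0\<close>.\<close>

lemma H_0_elimination:
  defines "t \<equiv> fps_const (p * q) * fps_X" and "u \<equiv> fps_const (q * r) * fps_X"
    and "v \<equiv> fps_const (p * r) * fps_X"
  shows "(H 0 - 1) * (1 - t * H 0)\<^sup>2 =
    t * H 0 * (1 - t * H 0 + u * H 0) * (1 - t * H 0 + v * H 0)"
proof (rule growth_elimination)
  have "G 1 = 1 + fps_X * (fps_const (p * q) * G (1 + 2) + fps_const (p * q) * G 1)"
    by (subst G_eq) simp
  then show "G 1 = 1 + (t * growth * G 1 + t * G 1)"
    unfolding G_add_2[OF zero_less_one] t_def by (simp only: algebra_simps)
  have "{1..<2::nat} = {1}" by auto
  then have "G 2 = 1 + fps_X * (fps_const (p * q) * G (2 + 2) + fps_const (q * r) * G 1 +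
      fps_const (p * q) * G 2)"
    by (subst G_eq) (simp add: gap_wt_def)
  then show "G 2 = 1 + u * G 1 + (t * growth * G 2 + t * G 2)"
    unfolding G_add_2[OF pos2] t_def u_def by (simp only: algebra_simps)
  show "growth = 1 + u * G 1 + v * G 2"
    unfolding growth_def u_def v_def by (simp add: algebra_simps)
  have "H 0 = 1 + fps_X * (fps_const (p * q) * H (0 + 2))"
    by (subst H_eq) simp
  then show "H 0 = 1 + t * growth * H 0"
    unfolding H_add_2 t_def by (simp only: algebra_simps)
qed

end

text \<open>Both equations are the same cubic in \<open>f\<close>: the differences of their sides
  agree identically as polynomials.\<close>

lemma cubic_rearrange:
  fixes P Q R X f :: "'a::comm_ring_1"
  assumes "(f - 1) * (1 - P * Q * X * f)\<^sup>2 =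
    P * Q * X * f * (1 - P * Q * X * f + Q * R * X * f) * (1 - P * Q * X * f + P * R * X * f)"
  shows "f = 1 + P * Q * X * (- 1 + (2 + X * (P * R + Q * R - P * Q)) * f
    - P * Q * X * (1 - X * ((P - R) * (Q - R))) * f\<^sup>2) * f" (is "f = ?rhs")
proof -
  have "?rhs - f =
    P * Q * X * f * (1 - P * Q * X * f + Q * R * X * f) * (1 - P * Q * X * f + P * R * X * f) -
    (f - 1) * (1 - P * Q * X * f)\<^sup>2"
    by (simp add: algebra_simps power2_eq_square)
  then show ?thesis using assms by simp
qed

theorem theorem2p6:
  fixes p q r :: "'a::comm_ring_1" and f :: "'a fps"
  assumes "f = fps_const q * C123 p q r - fps_const q + 1"
  shows "f = 1 + fps_const (p * q) * fps_X *
           (- 1 + (2 + fps_X * fps_const (p * r + q * r - p * q)) * f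
              - fps_const (p * q) * fps_X * (1 - fps_X * fps_const ((p - r) * (q - r))) * f ^ 2) * f"
proof -
  \<comment> \<open>Splitting the constants exposes \<open>fps_const p\<close>,
    \<open>fps_const q\<close> and \<open>fps_const r\<close> as the \<open>P\<close>,
    \<open>Q\<close> and \<open>R\<close> of \<open>cubic_rearrange\<close>.\<close>
  have split_const: "fps_const (a * b) = fps_const a * fps_const b"
    "fps_const (a + b) = fps_const a + fps_const b"
    "fps_const (a - b) = fps_const a - fps_const b" for a b :: 'a
    by simp_all
  have "f = H p q r 0" using assms C123_eq_H by simp
  then have "(f - 1) * (1 - fps_const (p * q) * fps_X * f)\<^sup>2 = fps_const (p * q) * fps_X * f *
      (1 - fps_const (p * q) * fps_X * f + fps_const (q * r) * fps_X * f) *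
      (1 - fps_const (p * q) * fps_X * f + fps_const (p * r) * fps_X * f)"
    using H_0_elimination[of p q r] by simp
  then show ?thesis
    unfolding split_const by (rule cubic_rearrange)
qed

end
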